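(* The only solutions of the Diophantine equation $$F_1^2+2F_2^2+\cdots+kF_k^2=F_n$$ in positive integers $k$ and $n$ are the trivial solutions $(k,n)=(1,1)$, $(k,n)=(1,2)$ and $(k,n)=(2,4)$.
   Context: $(F_n)_{n\ge 0}$ is the Fibonacci sequence: $F_0=0$, $F_1=1$, $F_{n+2}=F_{n+1}+F_n$ for all $n\ge 0$. The left-hand side of the equation is $\sum_{j=1}^k jF_j^2$. For fixed positive integers $p,q$, the trivial solutions of $\sum_{j=1}^k jF_j^p=F_n^q$ in positive integers $k,n$ are those coming from $F_1^p=1=F_1^q=F_2^q$, i.e. $(k,n)=(1,1),(1,2)$, and from $F_1^p+2F_2^p=3=F_4$, i.e. $(k,n)=(2,4)$ when $q=1$. *)

theory Defs
  imports "HOL-Number_Theory.Fib"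
begin

end

theory Submission
  imports Defs
begin

text \<open>
  Summation by parts gives the closed form
  \<open>S k = k F\<^sub>k F\<^sub>k\<^sub>+\<^sub>1 - F\<^sub>k\<^sup>2 + (k mod 2)\<close> for the left-hand side, so that \<open>S k\<close> is
  congruent to \<open>k mod 2\<close> modulo \<open>F\<^sub>k\<close> (\<open>sum_fib_sq\<close>).  Its size is about \<open>k F\<^sub>2\<^sub>k\<close> up to a
  constant factor, and \<open>k \<le> F\<^sub>k\<close> for \<open>k \<ge> 5\<close>.  Hence a solution of \<open>S k = F\<^sub>n\<close> has
  \<open>n = 2k + t\<close> with \<open>0 < t < k - 1\<close> once \<open>k \<ge> 5\<close> (\<open>sum_fib_sq_gt\<close>, \<open>sum_fib_sq_less\<close>).

  On the other hand \<open>F\<^sub>2\<^sub>k\<^sub>+\<^sub>t\<close> is congruent to \<open>(-1)\<^sup>k F\<^sub>t\<close> modulo \<open>F\<^sub>k\<close> (\<open>fib_shift_cong\<close>).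
  Comparing residues, \<open>F\<^sub>k\<close> divides \<open>F\<^sub>t\<close> if \<open>k\<close> is even and \<open>F\<^sub>t + 1\<close> if \<open>k\<close> is odd.  Both are
  positive and, as \<open>t\<close> is at most \<open>k - 2\<close>, smaller than \<open>F\<^sub>k\<close>, which is impossible.  The values
  \<open>S 3 = 15\<close> and \<open>S 4 = 51\<close> lie strictly between consecutive Fibonacci numbers.
\<close>

lemma fib_Cassini_parity:
  "int (fib (Suc k) * fib k) + (int (fib k))\<^sup>2 = (int (fib (Suc k)))\<^sup>2 - (-1) ^ k"
proof -
  have "int (fib (Suc (Suc k)) * fib k) - int ((fib (Suc k))\<^sup>2) = - ((-1) ^ k)"
    by (simp only: fib_Cassini_int)
  then show ?thesis
    by (simp add: algebra_simps power2_eq_square)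
qed

text \<open>
  The remainder left by summation by parts is the sum of the products \<open>F\<^sub>j F\<^sub>j\<^sub>+\<^sub>1\<close>, which is a
  square up to a parity correction; in the induction this correction is Cassini's identity.
\<close>

lemma sum_fib_sq:
  "(\<Sum>j = 1..k. j * (fib j)\<^sup>2) + (fib k)\<^sup>2 = k * (fib k * fib (Suc k)) + k mod 2"
proof (induction k)
  case 0
  show ?case by simp
next
  case (Suc k)
  have parity: "int (k mod 2) + (-1) ^ k = int (Suc k mod 2)"
    by (cases "even k") (simp_all add: even_iff_mod_2_eq_zero odd_iff_mod_2_eq_one mod_Suc)
  have IH: "int (\<Sum>j = 1..k. j * (fib j)\<^sup>2) + (int (fib k))\<^sup>2
      = int k * (int (fib k) * int (fib (Suc k))) + int (k mod 2)"
    using arg_cong[OF Suc.IH, of int] by simp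
  have "int ((\<Sum>j = 1..Suc k. j * (fib j)\<^sup>2) + (fib (Suc k))\<^sup>2)
      = int (Suc k * (fib (Suc k) * fib (Suc (Suc k))) + Suc k mod 2)"
    using IH fib_Cassini_parity[of k]
    unfolding of_nat_add[of _ "Suc k mod 2"] parity[symmetric]
    by (simp add: algebra_simps power2_eq_square)
  then show ?case by (simp only: of_nat_eq_iff)
qed

lemma fib_double: "fib (2 * Suc m) = fib (Suc m) * (fib (Suc (Suc m)) + fib m)"
proof -
  have "fib (2 * Suc m) = fib (Suc (Suc m + m))" by (simp only: mult_2 add_Suc_right)
  then show ?thesis unfolding fib_add[of "Suc m" m] by (simp only: algebra_simps)
qed

lemma fib_double_pred: "fib (Suc (2 * m)) = (fib (Suc m))\<^sup>2 + (fib m)\<^sup>2"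
  using fib_add[of m m] by (simp add: mult_2 power2_eq_square)

text \<open>
  Modulo \<open>F\<^sub>k\<close> the addition formula keeps only the term \<open>F\<^sub>2\<^sub>k\<^sub>-\<^sub>1 F\<^sub>t\<close>, and \<open>F\<^sub>2\<^sub>k\<^sub>-\<^sub>1\<close> reduces to
  \<open>F\<^sub>k\<^sub>-\<^sub>1\<^sup>2\<close>, which Cassini's identity evaluates.
\<close>

lemma fib_shift_cong:
  assumes "0 < k"
  shows "int (fib k) dvd int (fib (2 * k + t)) - (-1) ^ k * int (fib t)"
proof -
  obtain m where k: "k = Suc m" using assms gr0_conv_Suc by auto
  have "fib (2 * k + t) = fib (Suc (Suc (2 * m) + t))" by (simp add: k)
  also have "\<dots> = fib (Suc t) * fib (2 * k) + fib t * fib (Suc (2 * m))"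
    by (subst fib_add) (simp add: k)
  finally have "int (fib (2 * k + t))
      = int (fib (Suc t)) * int (fib (2 * k)) + int (fib t) * int (fib (Suc (2 * m)))"
    by simp
  moreover have "int (fib (Suc (2 * m)))
      = (int (fib k))\<^sup>2 + ((int (fib k))\<^sup>2 - int (fib k) * int (fib m) + (-1) ^ k)"
    unfolding fib_double_pred using fib_Cassini_parity[of m] by (simp add: k)
  moreover have "int (fib (2 * k)) = int (fib k) * int (fib (Suc k) + fib m)"
    using fib_double[of m] by (simp add: k)
  ultimately have "int (fib (2 * k + t)) - (-1) ^ k * int (fib t)
      = int (fib k) * (int (fib (Suc t)) * int (fib (Suc k) + fib m)
          + int (fib t) * (2 * int (fib k) - int (fib m)))"
    by (simp only:) (simp add: algebra_simps power2_eq_square)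
  then show ?thesis by simp
qed

lemma sum_fib_sq_gt:
  assumes "3 \<le> k"
  shows "fib (2 * k) < (\<Sum>j = 1..k. j * (fib j)\<^sup>2)"
proof -
  obtain m where k: "k = Suc m" using assms by (cases k) auto
  have pos: "0 < fib k" "0 < fib (Suc k)" by (simp_all only: k fib_neq_0_nat zero_less_Suc)
  have "fib (2 * k) + (fib k)\<^sup>2 = 2 * (fib k * fib (Suc k))"
    using fib_double[of m] by (simp add: k algebra_simps power2_eq_square)
  also have "\<dots> < k * (fib k * fib (Suc k))" using assms pos by simp
  also have "\<dots> \<le> (\<Sum>j = 1..k. j * (fib j)\<^sup>2) + (fib k)\<^sup>2"
    unfolding sum_fib_sq by simp
  finally show ?thesis by simp
qed

lemma le_fib:
  assumes "5 \<le> k"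
  shows "k \<le> fib k"
  using assms
proof (induction k rule: dec_induct)
  case base
  show ?case by (simp add: numeral_eq_Suc)
next
  case (step k)
  from step.hyps obtain m where "k = Suc m" "0 < m" by (cases k) auto
  moreover from \<open>0 < m\<close> have "0 < fib m" by (rule fib_neq_0_nat)
  ultimately show ?case using step.IH by simp
qed

text \<open>
  As \<open>k \<le> F\<^sub>k\<close>, the sum is less than \<open>F\<^sub>k F\<^sub>2\<^sub>k\<close>, which is the larger of the two terms of
  \<open>F\<^sub>3\<^sub>k\<^sub>-\<^sub>1\<close> in the addition formula.
\<close>

lemma sum_fib_sq_less:
  assumes "5 \<le> k"
  shows "(\<Sum>j = 1..k. j * (fib j)\<^sup>2) < fib (3 * k - 1)"
proof -
  obtain m where k: "k = Suc m" "4 \<le> m" using assms by (cases k) auto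
  have pos: "0 < fib k" "0 < fib m" using k by (simp_all only: fib_neq_0_nat)
  have "(\<Sum>j = 1..k. j * (fib j)\<^sup>2) + (fib k)\<^sup>2 \<le> k * (fib k * fib (Suc k)) + 1"
    unfolding sum_fib_sq using mod_less_divisor[of 2 k] by linarith
  moreover have "1 \<le> (fib k)\<^sup>2" using pos by simp
  ultimately have "(\<Sum>j = 1..k. j * (fib j)\<^sup>2) \<le> k * (fib k * fib (Suc k))" by linarith
  also have "\<dots> \<le> fib k * (fib k * fib (Suc k))"
    using le_fib[OF assms] by (rule mult_le_mono1)
  also have "\<dots> < fib k * (fib k * (fib (Suc k) + fib m))" using pos by simp
  also have "\<dots> = fib k * fib (2 * k)" using fib_double[of m] by (simp add: k)
  also have "\<dots> \<le> fib (Suc (2 * m + 1 + m))"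
    unfolding fib_add[of "2 * m + 1" m] by (simp add: k)
  also have "Suc (2 * m + 1 + m) = 3 * k - 1" by (simp add: k)
  finally show ?thesis .
qed

lemma not_fib_between:
  assumes "fib m < x" "x < fib (Suc m)"
  shows "x \<noteq> fib n"
proof
  assume "x = fib n"
  then show False
    using assms fib_mono[of n m] fib_mono[of "Suc m" n] by (cases "n \<le> m") auto
qed

lemma sum_fib_sq_neq_fib:
  assumes "5 \<le> k"
  shows "(\<Sum>j = 1..k. j * (fib j)\<^sup>2) \<noteq> fib n"
proof
  assume eq: "(\<Sum>j = 1..k. j * (fib j)\<^sup>2) = fib n"
  have "2 * k < n"
    using sum_fib_sq_gt[of k] assms fib_mono[of n "2 * k"] eq by linarith
  then obtain t where n: "n = 2 * k + t" and t: "0 < t" by (metis less_imp_add_positive)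
  have "n < 3 * k - 1"
    using sum_fib_sq_less[OF assms] fib_mono[of "3 * k - 1" n] eq by linarith
  then have "t \<le> k - 2" using n by linarith
  then have "fib t \<le> fib (k - 2)" by (rule fib_mono)
  moreover have "fib k = fib (k - 1) + fib (k - 2)"
  proof -
    from assms have "k = Suc (Suc (k - 2))" by linarith
    then obtain m where "k = Suc (Suc m)" ..
    then show ?thesis by simp
  qed
  moreover have "2 \<le> fib (k - 1)"
    using fib_mono[of 3 "k - 1"] assms by (simp add: numeral_eq_Suc)
  \<comment> \<open>The summand \<open>F\<^sub>k\<^sub>-\<^sub>1 \<ge> 2\<close> leaves room for the extra 1 that appears when \<open>k\<close> is odd.\<close>
  ultimately have small: "fib t + 1 < fib k" by linarith
  have "int (fib n) + (int (fib k))\<^sup>2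
      = int k * (int (fib k) * int (fib (Suc k))) + int (k mod 2)"
    using arg_cong[OF sum_fib_sq[of k, unfolded eq], of int]
    by (simp only: of_nat_add of_nat_mult of_nat_power)
  then have "int (fib n) - int (k mod 2) = int (fib k) * (int k * int (fib (Suc k)) - int (fib k))"
    by (simp add: algebra_simps power2_eq_square)
  then have "int (fib k) dvd int (fib n) - int (k mod 2)" by simp
  from dvd_diff[OF this fib_shift_cong[of k t, folded n]] assms
  have dvd: "int (fib k) dvd (-1) ^ k * int (fib t) - int (k mod 2)" by simp
  show False
  proof (cases "even k")
    case True
    then have "fib k dvd fib t"
      using dvd by (simp add: even_iff_mod_2_eq_zero)
    moreover have "0 < fib t" using t by (rule fib_neq_0_nat)
    ultimately show False using small by (auto dest: dvd_imp_le)
  next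
    case False
    then have "(-1) ^ k * int (fib t) - int (k mod 2) = - int (fib t + 1)"
      by (simp add: odd_iff_mod_2_eq_one)
    with dvd have "int (fib k) dvd - int (fib t + 1)" by (simp only:)
    then have "fib k dvd fib t + 1" unfolding dvd_minus_iff of_nat_dvd_iff .
    then show False using small by (auto dest: dvd_imp_le)
  qed
qed

lemma fib_eq_1_iff: "fib n = 1 \<longleftrightarrow> n = 1 \<or> n = 2"
proof
  assume "fib n = 1"
  moreover have "2 \<le> fib n" if "3 \<le> n"
    using fib_mono[OF that] by (simp add: numeral_eq_Suc)
  moreover have "n \<noteq> 0" using \<open>fib n = 1\<close> by (intro notI) simp
  ultimately show "n = 1 \<or> n = 2" by (cases "3 \<le> n") auto
qed (auto simp: numeral_eq_Suc)

lemma fib_eq_3_iff: "fib n = 3 \<longleftrightarrow> n = 4"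
proof
  assume *: "fib n = 3"
  show "n = 4"
    using * fib_mono[of n 3] fib_mono[of 5 n]
    by (cases "n \<le> 3"; cases "5 \<le> n") (auto simp: numeral_eq_Suc)
qed (auto simp: numeral_eq_Suc)

theorem theorem4:
  shows "{(k, n). 0 < k \<and> 0 < n \<and> (\<Sum>j = 1..k. j * (fib j)\<^sup>2) = fib n}
         = {(1, 1), (1, 2), (2, 4)}"
proof -
  have S1: "(\<Sum>j = 1..1. j * (fib j)\<^sup>2) = 1"
    and S2: "(\<Sum>j = 1..2. j * (fib j)\<^sup>2) = 3"
    and S3: "(\<Sum>j = 1..3. j * (fib j)\<^sup>2) = 15"
    and S4: "(\<Sum>j = 1..4. j * (fib j)\<^sup>2) = 51"
    by (simp_all add: numeral_eq_Suc)
  have "0 < k \<and> 0 < n \<and> (\<Sum>j = 1..k. j * (fib j)\<^sup>2) = fib n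
      \<longleftrightarrow> (k = 1 \<and> (n = 1 \<or> n = 2)) \<or> (k = 2 \<and> n = 4)" for k n
  proof -
    consider "k = 0" | "k = 1" | "k = 2" | "k = 3" | "k = 4" | "5 \<le> k" by linarith
    then show ?thesis
    proof cases
      case 2
      then show ?thesis using S1 fib_eq_1_iff[of n] by auto
    next
      case 3
      then show ?thesis using S2 fib_eq_3_iff[of n] by auto
    next
      case 4
      have "15 \<noteq> fib n" by (rule not_fib_between[of 7]) (simp_all add: numeral_eq_Suc)
      then show ?thesis using 4 S3 by auto
    next
      case 5
      have "51 \<noteq> fib n" by (rule not_fib_between[of 9]) (simp_all add: numeral_eq_Suc)
      then show ?thesis using 5 S4 by auto
    next
      case 6
      then show ?thesis using sum_fib_sq_neq_fib[of k n] by auto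
    qed simp
  qed
  then show ?thesis by auto
qed

end
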